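(* Let $s\in\mathbb C$. Consider a charge-preserving fermionic operator of the form $T=(w_0P^0_{\bar\vartheta}+w_1P^1_{\bar\vartheta})\,\partial_\vartheta$, i.e. first order in $\partial_\vartheta$, preserving the two opposite-occupancy sectors, and with coefficients $w_0,w_1$ in the polynomial Weyl algebra. Then on the empty opposite-occupancy sector its coefficient $w_0$ has a unique right-normal form $bF(B_{\rm f})$ with $F\in\mathbb C[B]$. Requiring the boundary value $T(\vartheta a)=-s+2iB_{\rm f}$ forces $$F(B)=\frac{4-s+2iB}{B-i}.$$ Hence no polynomial seed in this class has the required boundary when $s\ne2$.
   Context: $\vartheta,\bar\vartheta$ are Grassmann generators with left Berezin derivatives $\partial_\vartheta,\partial_{\bar\vartheta}$; $P^0_{\bar\vartheta},P^1_{\bar\vartheta}$ are the projectors onto the eigenspaces $0,1$ of $\bar\vartheta\partial_{\bar\vartheta}$ (the empty and occupied opposite-occupancy sectors). The Weyl algebra is generated by $a,b$, commuting with $\vartheta,\bar\vartheta$, with $ab-ba=-2i$; $B_{\rm f}=ba-i$, so that $bR(B_{\rm f})=R(B_{\rm f}+2i)b$ and $aR(B_{\rm f})=R(B_{\rm f}-2i)a$. Weyl elements act by left multiplication on the algebra generated by $\vartheta,\bar\vartheta,a,b$. The charge grading assigns charge $+1$ to $a$ and $\bar\vartheta$, and $-1$ to $b$ and $\vartheta$. *)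

theory Defs
  imports
    Complex_Main
    "HOL-Library.Poly_Mapping"
    "HOL-Computational_Algebra.Polynomial"
    "HOL-Computational_Algebra.Fraction_Field"
begin

datatype gen = Gen_a | Gen_b

datatype gen_word = Word (letters: "gen list")

instantiation gen_word :: monoid_add
begin
definition "0 = Word []"
definition "u + v = Word (letters u @ letters v)"
instance by standard (auto simp: zero_gen_word_def plus_gen_word_def)
end

text \<open>
  Concatenation of words is written additively, so that the convolution product of
  \<^theory>\<open>HOL-Library.Poly_Mapping\<close> makes the following type the free unital complex
  algebra on two generators.
\<close>

type_synonym free_alg = "gen_word \<Rightarrow>\<^sub>0 complex"

definition free_gen :: "gen \<Rightarrow> free_alg" where
  "free_gen g = Poly_Mapping.single (Word [g]) 1"

definition free_scalar :: "complex \<Rightarrow> free_alg" where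
  "free_scalar c = Poly_Mapping.single 0 c"

definition weyl_relator :: free_alg where
  "weyl_relator = free_gen Gen_a * free_gen Gen_b - free_gen Gen_b * free_gen Gen_a
                  - free_scalar (-2 * \<i>)"

inductive_set weyl_ideal :: "free_alg set" where
  zero: "0 \<in> weyl_ideal"
| add: "x \<in> weyl_ideal \<Longrightarrow> y \<in> weyl_ideal \<Longrightarrow> x + y \<in> weyl_ideal"
| gen: "x * weyl_relator * y \<in> weyl_ideal"

definition weyl_cong :: "free_alg \<Rightarrow> free_alg \<Rightarrow> bool" where
  "weyl_cong x y \<longleftrightarrow> x - y \<in> weyl_ideal"

lemma weyl_ideal_mult: "x \<in> weyl_ideal \<Longrightarrow> u * x * v \<in> weyl_ideal"
proof (induction rule: weyl_ideal.induct)
  case (gen x y)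
  have "u * (x * weyl_relator * y) * v = (u * x) * weyl_relator * (y * v)"
    by (simp add: mult.assoc)
  then show ?case by (metis weyl_ideal.gen)
qed (auto simp: algebra_simps intro: weyl_ideal.intros)

lemma weyl_ideal_multl: "x \<in> weyl_ideal \<Longrightarrow> u * x \<in> weyl_ideal"
  using weyl_ideal_mult[of x u 1] by simp

lemma weyl_ideal_multr: "x \<in> weyl_ideal \<Longrightarrow> x * v \<in> weyl_ideal"
  using weyl_ideal_mult[of x 1 v] by simp

lemma weyl_ideal_uminus: "x \<in> weyl_ideal \<Longrightarrow> - x \<in> weyl_ideal"
  using weyl_ideal_multl[of x "-1"] by simp

lemma weyl_cong_eqI: "x = y \<Longrightarrow> weyl_cong x y"
  by (simp add: weyl_cong_def weyl_ideal.zero)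

lemma equivp_weyl_cong: "equivp weyl_cong"
proof (rule equivpI)
  show "reflp weyl_cong"
    by (auto simp: reflp_def weyl_cong_def intro: weyl_ideal.zero)
  show "symp weyl_cong"
    unfolding symp_def weyl_cong_def by (metis minus_diff_eq weyl_ideal_uminus)
  show "transp weyl_cong"
  proof (rule transpI)
    fix x y z assume "weyl_cong x y" "weyl_cong y z"
    then have "(x - y) + (y - z) \<in> weyl_ideal"
      unfolding weyl_cong_def by (rule weyl_ideal.add)
    then show "weyl_cong x z" by (simp add: weyl_cong_def)
  qed
qed

text \<open>
  Realization on polynomials, with $b$ acting as multiplication by the variable and $a$ as
  $-2i$ times the derivative; it shows that the quotient below is not the zero ring.
\<close>

fun act_gen :: "gen \<Rightarrow> complex poly \<Rightarrow> complex poly" where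
  "act_gen Gen_a p = smult (-2 * \<i>) (pderiv p)"
| "act_gen Gen_b p = pCons 0 p"

definition act_word :: "gen_word \<Rightarrow> complex poly \<Rightarrow> complex poly" where
  "act_word w p = foldr act_gen (letters w) p"

definition act :: "free_alg \<Rightarrow> complex poly \<Rightarrow> complex poly" where
  "act x p = (\<Sum>w\<in>Poly_Mapping.keys x. smult (Poly_Mapping.lookup x w) (act_word w p))"

lemma act_gen_linear:
  "act_gen g (p + q) = act_gen g p + act_gen g q"
  "act_gen g (smult c p) = smult c (act_gen g p)"
  by (cases g, simp_all add: pderiv_add pderiv_smult smult_add_right mult.commute)+

lemma act_word_linear:
  "act_word w (p + q) = act_word w p + act_word w q"
  "act_word w (smult c p) = smult c (act_word w p)"
proof -
  have "foldr act_gen gs (p + q) = foldr act_gen gs p + foldr act_gen gs q"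
       "foldr act_gen gs (smult c p) = smult c (foldr act_gen gs p)" for gs
    by (induction gs) (simp_all add: act_gen_linear)
  then show "act_word w (p + q) = act_word w p + act_word w q"
    and "act_word w (smult c p) = smult c (act_word w p)"
    by (simp_all add: act_word_def)
qed

lemma act_word_add: "act_word (u + v) p = act_word u (act_word v p)"
  by (simp add: act_word_def plus_gen_word_def)

lemma act_superset:
  assumes "finite S" "Poly_Mapping.keys x \<subseteq> S"
  shows "act x p = (\<Sum>w\<in>S. smult (Poly_Mapping.lookup x w) (act_word w p))"
  unfolding act_def
  by (rule sum.mono_neutral_left) (use assms in \<open>auto simp: in_keys_iff\<close>)

lemma act_zero [simp]: "act 0 p = 0"
  by (simp add: act_def)

lemma act_add: "act (x + y) p = act x p + act y p"
proof -
  let ?S = "Poly_Mapping.keys x \<union> Poly_Mapping.keys y"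
  have "Poly_Mapping.keys (x + y) \<subseteq> ?S"
    by (rule Poly_Mapping.keys_add)
  then show ?thesis
    by (simp add: act_superset[of ?S] lookup_add smult_add_left sum.distrib)
qed

lemma act_uminus: "act (- x) p = - act x p"
  using act_add[of x "- x" p] by (simp add: eq_neg_iff_add_eq_0 add.commute)

lemma act_diff: "act (x - y) p = act x p - act y p"
  using act_add[of x "- y" p] by (simp add: act_uminus)

lemma act_linear:
  "act x (p + q) = act x p + act x q"
  "act x (smult c p) = smult c (act x p)"
proof -
  show "act x (p + q) = act x p + act x q"
    unfolding act_def by (simp add: act_word_linear smult_add_right sum.distrib)
  have "smult c (\<Sum>w\<in>S. h w) = (\<Sum>w\<in>S. smult c (h w))" for h :: "gen_word \<Rightarrow> complex poly" and S
    by (induction S rule: infinite_finite_induct) (simp_all add: smult_add_right)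
  then show "act x (smult c p) = smult c (act x p)"
    unfolding act_def by (simp add: act_word_linear mult.commute)
qed

lemma act_single: "act (Poly_Mapping.single w c) p = smult c (act_word w p)"
  by (simp add: act_superset[of "{w}"])

lemma free_alg_induct [case_names zero single_add]:
  assumes "P 0" "\<And>w c x. P x \<Longrightarrow> P (Poly_Mapping.single w c + x)"
  shows "P (x :: free_alg)"
proof (induction x rule: update_induct)
  case const
  then show ?case using assms(1) by simp
next
  case (update x w c)
  have "Poly_Mapping.update w c x = Poly_Mapping.single w c + x"
    by (rule poly_mapping_eqI)
       (use update in \<open>auto simp: lookup_update lookup_add lookup_single when_def in_keys_iff\<close>)
  then show ?case using assms(2) update by simp
qed

lemma act_mult: "act (x * y) p = act x (act y p)"
proof (induction x rule: free_alg_induct)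
  case zero
  then show ?case by simp
next
  case (single_add w c x)
  have "act (Poly_Mapping.single w c * y) p = smult c (act_word w (act y p))"
  proof (induction y rule: free_alg_induct)
    case zero
    then show ?case using act_word_linear(2)[of w 0 0] by simp
  next
    case (single_add v d y)
    then show ?case
      by (simp add: distrib_left act_add act_single mult_single act_word_add act_word_linear
          smult_add_right)
  qed
  then show ?case using single_add by (simp add: distrib_right act_add act_single)
qed

lemma act_weyl_relator: "act weyl_relator p = 0"
  by (simp add: weyl_relator_def act_diff act_mult free_gen_def free_scalar_def act_single
      act_word_def zero_gen_word_def pderiv_pCons smult_add_right pderiv_smult)

lemma act_weyl_ideal: "x \<in> weyl_ideal \<Longrightarrow> act x p = 0"
proof (induction arbitrary: p rule: weyl_ideal.induct)
  case (gen x y)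
  then show ?case using act_linear(2)[of x 0 0] by (simp add: act_mult act_weyl_relator)
qed (simp_all add: act_add)

quotient_type weyl = free_alg / weyl_cong
  by (rule equivp_weyl_cong)

instantiation weyl :: ring_1
begin

lift_definition zero_weyl :: weyl is 0 .
lift_definition one_weyl :: weyl is 1 .

lift_definition plus_weyl :: "weyl \<Rightarrow> weyl \<Rightarrow> weyl" is "(+)"
  by (simp add: weyl_cong_def add_diff_add weyl_ideal.add)

lift_definition uminus_weyl :: "weyl \<Rightarrow> weyl" is uminus
  using weyl_ideal_uminus by (fastforce simp: weyl_cong_def)

lift_definition minus_weyl :: "weyl \<Rightarrow> weyl \<Rightarrow> weyl" is "(-)"
proof -
  fix x x' y y' assume "weyl_cong x x'" "weyl_cong y y'"
  then have "(x - x') + - (y - y') \<in> weyl_ideal"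
    unfolding weyl_cong_def by (intro weyl_ideal.add weyl_ideal_uminus)
  then show "weyl_cong (x - y) (x' - y')"
    by (simp add: weyl_cong_def algebra_simps)
qed

lift_definition times_weyl :: "weyl \<Rightarrow> weyl \<Rightarrow> weyl" is "(*)"
proof -
  fix x x' y y' assume "weyl_cong x x'" "weyl_cong y y'"
  then have "(x - x') * y + x' * (y - y') \<in> weyl_ideal"
    unfolding weyl_cong_def by (intro weyl_ideal.add weyl_ideal_multl weyl_ideal_multr)
  then show "weyl_cong (x * y) (x' * y')"
    by (simp add: weyl_cong_def algebra_simps)
qed

instance
proof
  fix x y z :: weyl
  show "x + y + z = x + (y + z)" "x + y = y + x" "0 + x = x" "- x + x = 0" "x - y = x + - y"
    by (transfer, rule weyl_cong_eqI, simp)+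
  show "x * y * z = x * (y * z)" "1 * x = x" "x * 1 = x"
    by (transfer, rule weyl_cong_eqI, simp add: mult.assoc)+
  show "(x + y) * z = x * z + y * z" "x * (y + z) = x * y + x * z"
    by (transfer, rule weyl_cong_eqI, simp add: distrib_left distrib_right)+
  have "\<not> weyl_cong 0 1"
  proof
    assume "weyl_cong 0 1"
    then have "act (- 1) 1 = 0"
      by (simp add: weyl_cong_def act_weyl_ideal)
    moreover have "act 1 1 = 1"
      using act_single[of 0 1 1]
      by (simp only: single_one) (simp add: act_word_def zero_gen_word_def)
    ultimately show False by (simp add: act_uminus)
  qed
  then show "(0::weyl) \<noteq> 1"
    by (simp add: zero_weyl_def one_weyl_def weyl.abs_eq_iff)
qed

end

lift_definition weyl_scalar :: "complex \<Rightarrow> weyl" is free_scalar .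
lift_definition weyl_a :: weyl is "free_gen Gen_a" .
lift_definition weyl_b :: weyl is "free_gen Gen_b" .

lemma weyl_relation: "weyl_a * weyl_b - weyl_b * weyl_a = weyl_scalar (-2 * \<i>)"
  using weyl_ideal.gen[of 1 1]
  by transfer (simp add: weyl_cong_def weyl_relator_def)

definition B_f :: weyl where
  "B_f = weyl_b * weyl_a - weyl_scalar \<i>"

definition weyl_eval :: "complex poly \<Rightarrow> weyl \<Rightarrow> weyl" where
  "weyl_eval F x = (\<Sum>k\<le>degree F. weyl_scalar (coeff F k) * x ^ k)"

text \<open>
  \<open>Grass x y z w\<close> stands for
  $x + \vartheta\, y + \bar\vartheta\, z + \vartheta\bar\vartheta\, w$, where the
  coefficients commute with $\vartheta, \bar\vartheta$.
\<close>

datatype 'a grass = Grass (c_empty: 'a) (c_th: 'a) (c_thbar: 'a) (c_both: 'a)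

instantiation grass :: (ring_1) ring_1
begin

definition "0 = Grass 0 0 0 0"
definition "1 = Grass 1 0 0 0"
definition "f + g = Grass (c_empty f + c_empty g) (c_th f + c_th g)
                          (c_thbar f + c_thbar g) (c_both f + c_both g)"
definition "- f = Grass (- c_empty f) (- c_th f) (- c_thbar f) (- c_both f)"
definition "f - g = Grass (c_empty f - c_empty g) (c_th f - c_th g)
                          (c_thbar f - c_thbar g) (c_both f - c_both g)"
definition "f * g = Grass
  (c_empty f * c_empty g)
  (c_empty f * c_th g + c_th f * c_empty g)
  (c_empty f * c_thbar g + c_thbar f * c_empty g)
  (c_empty f * c_both g + c_both f * c_empty g + c_th f * c_thbar g - c_thbar f * c_th g)"

instance
  by standard
    (simp_all add: zero_grass_def one_grass_def plus_grass_def uminus_grass_def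
      minus_grass_def times_grass_def algebra_simps)

end

lemmas grass_ring_defs = zero_grass_def one_grass_def plus_grass_def uminus_grass_def
  minus_grass_def times_grass_def

type_synonym superalg = "weyl grass"

definition coef :: "weyl \<Rightarrow> superalg" where
  "coef w = Grass w 0 0 0"

definition theta :: superalg where
  "theta = Grass 0 1 0 0"

definition theta_bar :: superalg where
  "theta_bar = Grass 0 0 1 0"

lemma grass_relations:
  "theta * theta = 0" "theta_bar * theta_bar = 0" "theta * theta_bar = - (theta_bar * theta)"
  "theta * coef w = coef w * theta" "theta_bar * coef w = coef w * theta_bar"
  by (simp_all add: theta_def theta_bar_def coef_def grass_ring_defs)

lemma grass_expansion:
  "f = coef (c_empty f) + theta * coef (c_th f) + theta_bar * coef (c_thbar f)
       + theta * theta_bar * coef (c_both f)"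
  by (cases f) (simp add: theta_def theta_bar_def coef_def grass_ring_defs)

text \<open>Left derivatives, so that
  $\partial_{\bar\vartheta}(\vartheta\bar\vartheta) = -\vartheta$.\<close>

definition d_theta :: "superalg \<Rightarrow> superalg" where
  "d_theta f = Grass (c_th f) 0 (c_both f) 0"

definition d_theta_bar :: "superalg \<Rightarrow> superalg" where
  "d_theta_bar f = Grass (c_thbar f) (- c_both f) 0 0"

lemma left_derivative_rules:
  "d_theta (coef w) = 0" "d_theta (theta * f) = f - theta * d_theta f"
  "d_theta (theta_bar * f) = - (theta_bar * d_theta f)"
  "d_theta_bar (coef w) = 0" "d_theta_bar (theta_bar * f) = f - theta_bar * d_theta_bar f"
  "d_theta_bar (theta * f) = - (theta * d_theta_bar f)"
  by (simp_all add: d_theta_def d_theta_bar_def theta_def theta_bar_def coef_def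
      grass_ring_defs)

definition occ_bar :: "superalg \<Rightarrow> superalg" where
  "occ_bar f = theta_bar * d_theta_bar f"

text \<open>
  The projectors of the decomposition of the algebra into the eigenspaces of
  \<^const>\<open>occ_bar\<close> for the eigenvalues $0$ and $1$.
\<close>

definition P0_bar :: "superalg \<Rightarrow> superalg" where
  "P0_bar f = (THE g. occ_bar g = 0 \<and> occ_bar (f - g) = f - g)"

definition P1_bar :: "superalg \<Rightarrow> superalg" where
  "P1_bar f = (THE g. occ_bar g = g \<and> occ_bar (f - g) = 0)"

lemma occ_bar_eq: "occ_bar f = Grass 0 0 (c_thbar f) (c_both f)"
  by (simp add: occ_bar_def d_theta_bar_def theta_bar_def grass_ring_defs)

lemma P0_bar_eq: "P0_bar f = Grass (c_empty f) (c_th f) 0 0"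
  unfolding P0_bar_def
proof (rule the_equality)
  show "g = Grass (c_empty f) (c_th f) 0 0"
    if "occ_bar g = 0 \<and> occ_bar (f - g) = f - g" for g
    using that by (cases g) (auto simp: occ_bar_eq grass_ring_defs)
qed (simp add: occ_bar_eq grass_ring_defs)

lemma P1_bar_eq: "P1_bar f = Grass 0 0 (c_thbar f) (c_both f)"
  unfolding P1_bar_def
proof (rule the_equality)
  show "g = Grass 0 0 (c_thbar f) (c_both f)"
    if "occ_bar g = g \<and> occ_bar (f - g) = 0" for g
    using that by (cases g) (auto simp: occ_bar_eq grass_ring_defs)
qed (simp add: occ_bar_eq grass_ring_defs)

text \<open>\<open>{f. has_charge n f}\<close> is the homogeneous component of degree $n$.\<close>

inductive has_charge :: "int \<Rightarrow> superalg \<Rightarrow> bool" where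
  zero: "has_charge n 0"
| scalar: "has_charge 0 (coef (weyl_scalar c))"
| a: "has_charge 1 (coef weyl_a)"
| b: "has_charge (-1) (coef weyl_b)"
| theta: "has_charge (-1) theta"
| theta_bar: "has_charge 1 theta_bar"
| add: "has_charge n f \<Longrightarrow> has_charge n g \<Longrightarrow> has_charge n (f + g)"
| mult: "has_charge m f \<Longrightarrow> has_charge n g \<Longrightarrow> has_charge (m + n) (f * g)"

definition charge_preserving :: "(superalg \<Rightarrow> superalg) \<Rightarrow> bool" where
  "charge_preserving T \<longleftrightarrow> (\<forall>n f. has_charge n f \<longrightarrow> has_charge n (T f))"

definition grass_even :: "superalg set" where
  "grass_even = {f. c_th f = 0 \<and> c_thbar f = 0}"

definition grass_odd :: "superalg set" where
  "grass_odd = {f. c_empty f = 0 \<and> c_both f = 0}"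

definition fermionic :: "(superalg \<Rightarrow> superalg) \<Rightarrow> bool" where
  "fermionic T \<longleftrightarrow> T ` grass_even \<subseteq> grass_odd \<and> T ` grass_odd \<subseteq> grass_even"

definition seed_op :: "weyl \<Rightarrow> weyl \<Rightarrow> superalg \<Rightarrow> superalg" where
  "seed_op w0 w1 f = coef w0 * P0_bar (d_theta f) + coef w1 * P1_bar (d_theta f)"

text \<open>
  Elements of the Weyl algebra are even, so oddness is automatic for these operators; it
  is kept in the definition below because it belongs to the description of the class.
\<close>

lemma fermionic_seed_op: "fermionic (seed_op w0 w1)"
  unfolding fermionic_def image_subset_iff grass_even_def grass_odd_def
  by (simp add: seed_op_def coef_def P0_bar_eq P1_bar_eq d_theta_def plus_grass_def
      times_grass_def)

definition polynomial_seed :: "weyl \<Rightarrow> weyl \<Rightarrow> (superalg \<Rightarrow> superalg) \<Rightarrow> bool" where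
  "polynomial_seed w0 w1 T \<longleftrightarrow> T = seed_op w0 w1 \<and> fermionic T \<and> charge_preserving T"

definition has_boundary :: "complex \<Rightarrow> (superalg \<Rightarrow> superalg) \<Rightarrow> bool" where
  "has_boundary s T \<longleftrightarrow>
     T (theta * coef weyl_a) = coef (weyl_scalar (- s) + weyl_scalar (2 * \<i>) * B_f)"

end

theory Submission
  imports Defs
begin

text \<open>
  The first-order coefficient $w_0 = T\vartheta$ inherits charge $-1$ from $\vartheta$. Commuting
  all occurrences of $B_{\rm f}$ to the right shows that the Weyl elements of charge $n$ are exactly
  $a^n G(B_{\rm f})$ for $n \ge 0$ and $b^{-n} G(B_{\rm f})$ for $n < 0$. In the realization on
  polynomials $B_{\rm f}$ acts on $x^k$ by the scalar $-(2k+1)i$ while $b$ acts injectively, and a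
  polynomial with infinitely many zeros vanishes; this gives uniqueness of $G$. The boundary
  condition $b F(B_{\rm f}) a = F(B_{\rm f} + 2i)(B_{\rm f} + i) = -s + 2iB_{\rm f}$ thus becomes
  a polynomial identity, and its value at $B = -i$ is $0 = 2 - s$.
\<close>

section \<open>Polynomials in a Weyl element\<close>

lemma weyl_scalar_simps [simp]:
  "weyl_scalar 0 = 0" "weyl_scalar 1 = 1"
  by (transfer, rule weyl_cong_eqI, simp add: free_scalar_def)+

lemma weyl_scalar_add: "weyl_scalar (c + d) = weyl_scalar c + weyl_scalar d"
  by (transfer, rule weyl_cong_eqI, simp add: free_scalar_def single_add)

lemma weyl_scalar_mult: "weyl_scalar (c * d) = weyl_scalar c * weyl_scalar d"
  by (transfer, rule weyl_cong_eqI, simp add: free_scalar_def mult_single)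

lemma weyl_scalar_uminus: "weyl_scalar (- c) = - weyl_scalar c"
  by (transfer, rule weyl_cong_eqI, simp add: free_scalar_def single_uminus)

lemma free_scalar_commute: "free_scalar c * x = x * free_scalar c"
proof (induction x rule: free_alg_induct)
  case zero
  then show ?case by simp
next
  case (single_add w d x)
  then show ?case
    by (simp add: distrib_left distrib_right free_scalar_def mult_single mult.commute)
qed

lemma weyl_scalar_commute: "x * weyl_scalar c = weyl_scalar c * x"
  by (transfer, rule weyl_cong_eqI, simp add: free_scalar_commute)

lemma weyl_scalar_left_commute: "x * (weyl_scalar c * y) = weyl_scalar c * (x * y)"
  by (metis mult.assoc weyl_scalar_commute)

text \<open>Padding with zero coefficients: the recursion for \<open>pCons\<close> sums up to
  \<open>Suc (degree F)\<close>, which overshoots the true degree when \<open>F = 0\<close>.\<close>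

lemma weyl_eval_superset:
  assumes "degree F \<le> n"
  shows "weyl_eval F x = (\<Sum>k\<le>n. weyl_scalar (coeff F k) * x ^ k)"
  unfolding weyl_eval_def
  by (rule sum.mono_neutral_left) (use assms in \<open>auto simp: coeff_eq_0\<close>)

lemma weyl_eval_0 [simp]: "weyl_eval 0 x = 0"
  by (simp add: weyl_eval_def)

lemma weyl_eval_pCons: "weyl_eval (pCons c F) x = weyl_scalar c + x * weyl_eval F x"
proof -
  have "weyl_eval (pCons c F) x
      = (\<Sum>k\<le>Suc (degree F). weyl_scalar (coeff (pCons c F) k) * x ^ k)"
    by (rule weyl_eval_superset) (simp add: degree_pCons_le)
  also have "\<dots> = weyl_scalar c + (\<Sum>k\<le>degree F. x * (weyl_scalar (coeff F k) * x ^ k))"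
    by (simp only: sum.atMost_Suc_shift) (simp add: weyl_scalar_left_commute)
  finally show ?thesis by (simp add: weyl_eval_def sum_distrib_left)
qed

lemma weyl_eval_add: "weyl_eval (F + G) x = weyl_eval F x + weyl_eval G x"
proof (induction F G rule: poly_induct2)
  case 0
  then show ?case by simp
next
  case (pCons c F d G)
  then show ?case by (simp add: weyl_eval_pCons weyl_scalar_add algebra_simps)
qed

lemma weyl_eval_smult: "weyl_eval (smult c F) x = weyl_scalar c * weyl_eval F x"
  by (induction F)
    (simp_all add: weyl_eval_pCons weyl_scalar_mult distrib_left weyl_scalar_left_commute)

text \<open>Evaluation is multiplicative although the ring is noncommutative, since the scalars are
  central and only powers of the single element \<open>x\<close> occur.\<close>

lemma weyl_eval_mult: "weyl_eval (F * G) x = weyl_eval F x * weyl_eval G x"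
  by (induction F)
    (simp_all add: weyl_eval_pCons weyl_eval_add weyl_eval_smult distrib_right mult.assoc)

text \<open>Moving \<open>u\<close> past one factor \<open>x\<close> turns it into
  \<open>x + c\<close>; doing so factor by factor shifts the argument of \<open>F\<close>, and
  \<open>[:c, 1:]\<close> encodes X + c.\<close>

lemma weyl_eval_intertwine:
  assumes "u * x = (x + weyl_scalar c) * u"
  shows "u * weyl_eval F x = weyl_eval (pcompose F [:c, 1:]) x * u"
proof (induction F)
  case 0
  then show ?case by simp
next
  case (pCons d F)
  have "u * weyl_eval (pCons d F) x = weyl_scalar d * u + (u * x) * weyl_eval F x"
    by (simp add: weyl_eval_pCons distrib_left weyl_scalar_commute mult.assoc)
  also have "\<dots> = weyl_scalar d * u + (x + weyl_scalar c) * (u * weyl_eval F x)"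
    by (simp only: assms mult.assoc)
  also have "\<dots> = weyl_eval (pcompose (pCons d F) [:c, 1:]) x * u"
    by (simp add: pCons.IH pcompose_pCons weyl_eval_pCons weyl_eval_add weyl_eval_mult
        weyl_eval_smult distrib_left distrib_right mult.assoc add_ac)
  finally show ?case .
qed

section \<open>Commutation of \<open>B_f\<close> with the generators\<close>

lemma b_mult_a: "weyl_b * weyl_a = B_f + weyl_scalar \<i>"
  by (simp add: B_f_def)

text \<open>\<open>B_f\<close> is the mean of ab and ba, which differ by -2i, so the two products
  lie symmetrically around it.\<close>

lemma a_mult_b: "weyl_a * weyl_b = B_f - weyl_scalar \<i>"
proof -
  have "weyl_scalar (-2 * \<i>) = - weyl_scalar \<i> - weyl_scalar \<i>"
    unfolding weyl_scalar_uminus[symmetric] diff_conv_add_uminus weyl_scalar_add[symmetric]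
    by simp
  then show ?thesis
    using weyl_relation by (simp add: B_f_def algebra_simps)
qed

text \<open>Splitting 2i into two equal summands lets plain ring identities cancel the
  scalars.\<close>

lemma weyl_scalar_2i: "weyl_scalar (2 * \<i>) = weyl_scalar \<i> + weyl_scalar \<i>"
  unfolding weyl_scalar_add[symmetric] by simp

lemma a_mult_B_f: "weyl_a * B_f = (B_f + weyl_scalar (- (2 * \<i>))) * weyl_a"
proof -
  have "weyl_a * B_f = (weyl_a * weyl_b) * weyl_a - weyl_a * weyl_scalar \<i>"
    by (simp add: B_f_def algebra_simps)
  then show ?thesis
    unfolding weyl_scalar_uminus weyl_scalar_2i
    by (simp add: a_mult_b weyl_scalar_commute algebra_simps)
qed

lemma b_mult_B_f: "weyl_b * B_f = (B_f + weyl_scalar (2 * \<i>)) * weyl_b"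
proof -
  have "B_f * weyl_b = weyl_b * (weyl_a * weyl_b) - weyl_scalar \<i> * weyl_b"
    by (simp add: B_f_def algebra_simps)
  then show ?thesis
    unfolding weyl_scalar_2i
    by (simp add: a_mult_b weyl_scalar_commute algebra_simps)
qed

lemmas a_mult_weyl_eval = weyl_eval_intertwine[OF a_mult_B_f]
  and b_mult_weyl_eval = weyl_eval_intertwine[OF b_mult_B_f]

section \<open>Faithfulness of the realization on polynomials\<close>

text \<open>The ideal acts by zero, so the action descends to the quotient, where it serves to tell
  Weyl elements apart.\<close>

lift_definition weyl_act :: "weyl \<Rightarrow> complex poly \<Rightarrow> complex poly" is act
proof -
  fix x y assume "weyl_cong x y"
  then have "act (x - y) p = 0" for p
    by (simp add: weyl_cong_def act_weyl_ideal)
  then show "act x = act y"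
    by (simp add: act_diff fun_eq_iff)
qed

lemma weyl_act_mult: "weyl_act (x * y) p = weyl_act x (weyl_act y p)"
  by transfer (rule act_mult)

lemma weyl_act_add: "weyl_act (x + y) p = weyl_act x p + weyl_act y p"
  by transfer (rule act_add)

lemma weyl_act_diff: "weyl_act (x - y) p = weyl_act x p - weyl_act y p"
  by transfer (rule act_diff)

lemma weyl_act_0 [simp]: "weyl_act 0 p = 0"
  by transfer simp

lemma weyl_act_smult: "weyl_act x (smult c p) = smult c (weyl_act x p)"
  by transfer (rule act_linear(2))

lemma weyl_act_scalar: "weyl_act (weyl_scalar c) p = smult c p"
  by transfer (simp add: free_scalar_def act_single act_word_def zero_gen_word_def)

lemma weyl_act_a: "weyl_act weyl_a p = smult (-2 * \<i>) (pderiv p)"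
  by transfer (simp add: free_gen_def act_single act_word_def)

lemma weyl_act_b: "weyl_act weyl_b p = pCons 0 p"
  by transfer (simp add: free_gen_def act_single act_word_def)

text \<open>a lowers x^k to -2ik x^(k-1), b raises it again, and the constant subtracts i. The cases
  on \<open>k\<close> expose the exponent k - 1.\<close>

lemma weyl_act_B_f: "weyl_act B_f (monom 1 k) = smult (- (2 * of_nat k + 1) * \<i>) (monom 1 k)"
proof (cases k)
  case 0
  then show ?thesis
    by (simp add: B_f_def weyl_act_diff weyl_act_mult weyl_act_a weyl_act_b weyl_act_scalar
        pderiv_monom smult_monom)
next
  case (Suc m)
  then show ?thesis
    by (simp add: B_f_def weyl_act_diff weyl_act_mult weyl_act_a weyl_act_b weyl_act_scalar
        pderiv_monom smult_monom monom_Suc[symmetric] diff_monom algebra_simps)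
qed

text \<open>Monomials are eigenvectors of \<open>B_f\<close>, so a polynomial in \<open>B_f\<close>
  acts by its value at the eigenvalue.\<close>

lemma weyl_act_eval:
  "weyl_act (weyl_eval F B_f) (monom 1 k)
     = smult (poly F (- (2 * of_nat k + 1) * \<i>)) (monom 1 k)"
proof (induction F)
  case 0
  then show ?case by simp
next
  case (pCons c F)
  then show ?case
    by (simp only: weyl_eval_pCons weyl_act_add weyl_act_mult weyl_act_smult weyl_act_scalar
        weyl_act_B_f poly_pCons smult_smult smult_add_left mult.commute)
qed

lemma b_weyl_eval_inj:
  assumes "weyl_b * weyl_eval F B_f = weyl_b * weyl_eval G B_f"
  shows "F = G"
proof -
  \<comment> \<open>\<open>?e k\<close> is the eigenvalue of \<open>B_f\<close> on x^k; there are
    infinitely many of them, and F - G vanishes at each because b is injective.\<close>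
  let ?e = "\<lambda>k::nat. - (2 * of_nat k + 1) * \<i> :: complex"
  have root: "poly (F - G) (?e k) = 0" for k
  proof -
    have "weyl_act (weyl_b * weyl_eval F B_f) (monom 1 k)
        = weyl_act (weyl_b * weyl_eval G B_f) (monom 1 k)"
      by (simp only: assms)
    then show ?thesis
      by (simp add: weyl_act_mult weyl_act_b weyl_act_eval smult_monom)
  qed
  have "inj ?e" by (auto intro!: injI)
  then have "infinite (range ?e)" by (rule range_inj_infinite)
  moreover have "range ?e \<subseteq> {z. poly (F - G) z = 0}" using root by blast
  ultimately have "infinite {z. poly (F - G) z = 0}" using infinite_super by blast
  then show ?thesis using poly_roots_finite[of "F - G"] by auto
qed

lemma weyl_eval_inj: "weyl_eval F B_f = weyl_eval G B_f \<Longrightarrow> F = G"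
  by (simp add: b_weyl_eval_inj)

section \<open>Normal forms of homogeneous elements\<close>

text \<open>The Weyl elements of charge \<open>n\<close>. At least one of the two \<open>nat\<close>
  exponents is zero, so a single formula covers both signs.\<close>

definition weyl_comp :: "int \<Rightarrow> weyl set" where
  "weyl_comp n = {x. \<exists>G. x = weyl_a ^ nat n * weyl_b ^ nat (- n) * weyl_eval G B_f}"

lemma weyl_comp_nonneg: "x \<in> weyl_comp (int n) \<longleftrightarrow> (\<exists>G. x = weyl_a ^ n * weyl_eval G B_f)"
  by (simp add: weyl_comp_def)

lemma weyl_comp_nonpos: "x \<in> weyl_comp (- int n) \<longleftrightarrow> (\<exists>G. x = weyl_b ^ n * weyl_eval G B_f)"
  by (simp add: weyl_comp_def)

lemma weyl_comp_0 [simp]: "0 \<in> weyl_comp n"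
  unfolding weyl_comp_def by (auto intro: exI[of _ 0])

lemma weyl_comp_add: "x \<in> weyl_comp n \<Longrightarrow> y \<in> weyl_comp n \<Longrightarrow> x + y \<in> weyl_comp n"
  unfolding weyl_comp_def
  by (auto simp: distrib_left[symmetric] weyl_eval_add[symmetric])

lemma weyl_comp_multr: "x \<in> weyl_comp n \<Longrightarrow> x * weyl_eval G B_f \<in> weyl_comp n"
  unfolding weyl_comp_def by (auto simp: mult.assoc weyl_eval_mult[symmetric])

lemma weyl_comp_scalar: "x \<in> weyl_comp n \<Longrightarrow> weyl_scalar c * x \<in> weyl_comp n"
  using weyl_comp_multr[of x n "[:c:]"] by (simp add: weyl_eval_pCons weyl_scalar_commute)

lemma weyl_comp_uminus: "x \<in> weyl_comp n \<Longrightarrow> - x \<in> weyl_comp n"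
  using weyl_comp_scalar[of x n "-1"] by (simp add: weyl_scalar_uminus)

lemma weyl_comp_diff: "x \<in> weyl_comp n \<Longrightarrow> y \<in> weyl_comp n \<Longrightarrow> x - y \<in> weyl_comp n"
  by (metis diff_conv_add_uminus weyl_comp_add weyl_comp_uminus)

lemma weyl_eval_mult_a_power: "\<exists>H. weyl_eval F B_f * weyl_a ^ n = weyl_a ^ n * weyl_eval H B_f"
proof (induction n arbitrary: F)
  case 0
  show ?case by auto
next
  case (Suc n)
  \<comment> \<open>The shift by +2i is chosen to cancel the -2i produced by moving a to the
    right.\<close>
  have "weyl_a * weyl_eval (pcompose F [:2 * \<i>, 1:]) B_f = weyl_eval F B_f * weyl_a"
    unfolding a_mult_weyl_eval
    by (simp add: pcompose_assoc[symmetric] pcompose_pCons)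
  then show ?case
    using Suc[of "pcompose F [:2 * \<i>, 1:]"] by (metis mult.assoc power_Suc)
qed

lemma weyl_eval_mult_b_power: "\<exists>H. weyl_eval F B_f * weyl_b ^ n = weyl_b ^ n * weyl_eval H B_f"
proof (induction n arbitrary: F)
  case 0
  show ?case by auto
next
  case (Suc n)
  have "weyl_b * weyl_eval (pcompose F [:- (2 * \<i>), 1:]) B_f = weyl_eval F B_f * weyl_b"
    unfolding b_mult_weyl_eval
    by (simp add: pcompose_assoc[symmetric] pcompose_pCons)
  then show ?case
    using Suc[of "pcompose F [:- (2 * \<i>), 1:]"] by (metis mult.assoc power_Suc)
qed

lemma weyl_comp_multl:
  assumes "x \<in> weyl_comp n"
  shows "weyl_eval F B_f * x \<in> weyl_comp n"
proof (cases n rule: int_cases2)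
  case (nonneg k)
  obtain G where G: "x = weyl_a ^ k * weyl_eval G B_f"
    using assms by (auto simp: nonneg weyl_comp_nonneg)
  obtain H where "weyl_eval F B_f * weyl_a ^ k = weyl_a ^ k * weyl_eval H B_f"
    using weyl_eval_mult_a_power by blast
  then have "weyl_eval F B_f * x = weyl_a ^ k * weyl_eval (H * G) B_f"
    by (simp add: G weyl_eval_mult flip: mult.assoc)
  then show ?thesis by (auto simp: nonneg weyl_comp_nonneg)
next
  case (nonpos k)
  obtain G where G: "x = weyl_b ^ k * weyl_eval G B_f"
    using assms by (auto simp: nonpos weyl_comp_nonpos)
  obtain H where "weyl_eval F B_f * weyl_b ^ k = weyl_b ^ k * weyl_eval H B_f"
    using weyl_eval_mult_b_power by blast
  then have "weyl_eval F B_f * x = weyl_b ^ k * weyl_eval (H * G) B_f"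
    by (simp add: G weyl_eval_mult flip: mult.assoc)
  then show ?thesis by (auto simp: nonpos weyl_comp_nonpos)
qed

text \<open>For n >= 0 the power of a grows by one; for n < 0 the new a meets a leading b, and ab
  collapses to a polynomial in \<open>B_f\<close>.\<close>

lemma weyl_comp_a:
  assumes "x \<in> weyl_comp n"
  shows "weyl_a * x \<in> weyl_comp (n + 1)"
proof (cases "n \<ge> 0")
  case True
  then obtain k where k: "n = int k" by (metis nonneg_int_cases)
  then show ?thesis
    using assms weyl_comp_nonneg[of _ "Suc k"] weyl_comp_nonneg[of x k]
    by (auto simp: mult.assoc add.commute)
next
  case False
  \<comment> \<open>\<open>k\<close> counts the b's that remain after one has been absorbed into ab,
    so n + 1 = -k.\<close>
  define k where "k = nat (- n - 1)"
  with False have k: "n = - int (Suc k)" by simp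
  obtain G where "x = weyl_b ^ Suc k * weyl_eval G B_f"
    using assms unfolding k weyl_comp_nonpos by blast
  then have "weyl_a * x = (weyl_a * weyl_b) * (weyl_b ^ k * weyl_eval G B_f)"
    by (simp add: mult.assoc)
  also have "\<dots> = weyl_eval [:- \<i>, 1:] B_f * (weyl_b ^ k * weyl_eval G B_f)"
    by (simp add: a_mult_b weyl_eval_pCons weyl_scalar_uminus)
  also have "\<dots> \<in> weyl_comp (- int k)"
    using weyl_comp_multl weyl_comp_nonpos by blast
  finally show ?thesis by (simp add: k)
qed

lemma weyl_comp_b:
  assumes "x \<in> weyl_comp n"
  shows "weyl_b * x \<in> weyl_comp (n - 1)"
proof (cases "n \<le> 0")
  case True
  then obtain k where k: "n = - int k" by (metis nonpos_int_cases)
  then obtain G where "x = weyl_b ^ k * weyl_eval G B_f"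
    using assms unfolding k weyl_comp_nonpos by blast
  then have "weyl_b * x \<in> weyl_comp (- int (Suc k))"
    unfolding weyl_comp_nonpos by (auto simp: mult.assoc)
  moreover have "- int (Suc k) = n - 1" by (simp add: k)
  ultimately show ?thesis by (simp only:)
next
  case False
  define k where "k = nat (n - 1)"
  with False have k: "n = int (Suc k)" by simp
  obtain G where "x = weyl_a ^ Suc k * weyl_eval G B_f"
    using assms unfolding k weyl_comp_nonneg by blast
  then have "weyl_b * x = (weyl_b * weyl_a) * (weyl_a ^ k * weyl_eval G B_f)"
    by (simp add: mult.assoc)
  also have "\<dots> = weyl_eval [:\<i>, 1:] B_f * (weyl_a ^ k * weyl_eval G B_f)"
    by (simp add: b_mult_a weyl_eval_pCons add.commute)
  also have "\<dots> \<in> weyl_comp (int k)"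
    using weyl_comp_multl weyl_comp_nonneg by blast
  finally show ?thesis by (simp add: k)
qed

section \<open>Multiplicativity of the charge components\<close>

lemma weyl_comp_a_power: "x \<in> weyl_comp n \<Longrightarrow> weyl_a ^ k * x \<in> weyl_comp (n + int k)"
proof (induction k)
  case (Suc k)
  then show ?case 
    using weyl_comp_a[of "weyl_a ^ k * x" "n + int k"] by (simp add: mult.assoc algebra_simps)
qed simp

lemma weyl_comp_b_power: "x \<in> weyl_comp n \<Longrightarrow> weyl_b ^ k * x \<in> weyl_comp (n - int k)"
proof (induction k)
  case (Suc k)
  then show ?case
    using weyl_comp_b[of "weyl_b ^ k * x" "n - int k"] by (simp add: mult.assoc algebra_simps)
qed simp

text \<open>The factor G(B_f) of \<open>x\<close> is first absorbed into \<open>y\<close> without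
  changing its charge; then the generators of \<open>x\<close> are applied one at a time.\<close>

lemma weyl_comp_mult:
  assumes "x \<in> weyl_comp m" "y \<in> weyl_comp n"
  shows "x * y \<in> weyl_comp (m + n)"
proof (cases m rule: int_cases2)
  case (nonneg k)
  then obtain G where "x = weyl_a ^ k * weyl_eval G B_f"
    using assms(1) by (auto simp: weyl_comp_nonneg)
  then show ?thesis
    using weyl_comp_a_power[OF weyl_comp_multl[OF assms(2)], of k G] nonneg
    by (simp add: mult.assoc add.commute)
next
  case (nonpos k)
  then obtain G where "x = weyl_b ^ k * weyl_eval G B_f"
    using assms(1) by (auto simp: weyl_comp_nonpos)
  then show ?thesis
    using weyl_comp_b_power[OF weyl_comp_multl[OF assms(2)], of k G] nonpos
    by (simp add: mult.assoc)
qed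

lemma weyl_comp_scalar_self: "weyl_scalar c \<in> weyl_comp 0"
  unfolding weyl_comp_def by (auto intro!: exI[of _ "[:c:]"] simp: weyl_eval_pCons)

text \<open>Each coefficient must compensate the charge of its Grassmann monomial: -1 for
  \<open>theta\<close>, +1 for \<open>theta_bar\<close>, 0 for their product.\<close>

lemma has_charge_coefs:
  assumes "has_charge n f"
  shows "c_empty f \<in> weyl_comp n \<and> c_th f \<in> weyl_comp (n + 1) \<and>
         c_thbar f \<in> weyl_comp (n - 1) \<and> c_both f \<in> weyl_comp n"
  using assms
proof induction
  case (mult m f n g)
  \<comment> \<open>The target charge is a separate variable, so that each term of the Grassmann
    product leaves only an integer identity to check.\<close>
  have shift: "x * y \<in> weyl_comp l"
    if "x \<in> weyl_comp i" "y \<in> weyl_comp j" "i + j = l" for x y i j l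
    using weyl_comp_mult that by blast
  show ?case
    using mult.IH
    by (auto simp: times_grass_def intro!: weyl_comp_add weyl_comp_diff elim!: shift)
next
  case (scalar c)
  then show ?case by (simp add: coef_def weyl_comp_scalar_self)
next
  case a
  then show ?case using weyl_comp_a[OF weyl_comp_scalar_self[of 1]] by (simp add: coef_def)
next
  case b
  then show ?case using weyl_comp_b[OF weyl_comp_scalar_self[of 1]] by (simp add: coef_def)
next
  case theta
  then show ?case using weyl_comp_scalar_self[of 1] by (simp add: theta_def)
next
  case theta_bar
  then show ?case using weyl_comp_scalar_self[of 1] by (simp add: theta_bar_def)
qed (simp_all add: zero_grass_def plus_grass_def weyl_comp_add)

section \<open>The boundary condition\<close>

text \<open>The derivative strips \<open>theta\<close> and leaves an element of the empty sector,
  fixed by \<open>P0_bar\<close> and killed by \<open>P1_bar\<close>.\<close>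

lemma seed_op_theta_coef: "seed_op w0 w1 (theta * coef x) = coef (w0 * x)"
  by (simp add: seed_op_def P0_bar_eq P1_bar_eq d_theta_def theta_def coef_def grass_ring_defs)

lemma polynomial_seed_normal_form:
  assumes "polynomial_seed w0 w1 T"
  shows "\<exists>!F. w0 = weyl_b * weyl_eval F B_f"
proof -
  have "has_charge (-1) (T theta)"
    using assms has_charge.theta by (auto simp: polynomial_seed_def charge_preserving_def)
  \<comment> \<open>Applying T to \<open>theta\<close> with coefficient 1 recovers \<open>w0\<close>
    itself, so \<open>w0\<close> inherits charge -1.\<close>
  moreover have "theta = theta * coef 1"
    by (simp add: theta_def coef_def grass_ring_defs)
  then have "T theta = coef w0"
    using assms seed_op_theta_coef[of w0 w1 1] by (simp add: polynomial_seed_def)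
  ultimately have "w0 \<in> weyl_comp (-1)"
    using has_charge_coefs by (fastforce simp: coef_def)
  then obtain F where "w0 = weyl_b * weyl_eval F B_f"
    using weyl_comp_nonpos[of w0 1] by auto
  then show ?thesis using b_weyl_eval_inj by blast
qed

text \<open>The formula for F with its denominator cleared, so that it is an identity of
  polynomials.\<close>

lemma boundary_poly_eq:
  assumes "polynomial_seed w0 w1 T" "has_boundary s T" "w0 = weyl_b * weyl_eval F B_f"
  shows "F * [:- \<i>, 1:] = [:4 - s, 2 * \<i>:]"
proof -
  \<comment> \<open>Moving b to the right past F(B_f) gives F(B_f + 2i).\<close>
  let ?F = "pcompose F [:2 * \<i>, 1:]"
  have "w0 * weyl_a = weyl_scalar (- s) + weyl_scalar (2 * \<i>) * B_f"
    using assms(1,2) seed_op_theta_coef[of w0 w1 weyl_a]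
    by (simp add: polynomial_seed_def has_boundary_def coef_def)
  moreover have "w0 * weyl_a = weyl_eval (?F * [:\<i>, 1:]) B_f"
  proof -
    have "w0 * weyl_a = weyl_eval ?F B_f * (weyl_b * weyl_a)"
      by (simp add: assms(3) b_mult_weyl_eval mult.assoc)
    also have "weyl_b * weyl_a = weyl_eval [:\<i>, 1:] B_f"
      by (simp add: b_mult_a weyl_eval_pCons add.commute)
    finally show ?thesis by (simp only: weyl_eval_mult)
  qed
  ultimately have "weyl_eval (?F * [:\<i>, 1:]) B_f = weyl_eval [:- s, 2 * \<i>:] B_f"
    by (simp add: weyl_eval_pCons weyl_scalar_commute)
  then have "?F * [:\<i>, 1:] = [:- s, 2 * \<i>:]"
    by (rule weyl_eval_inj)
  \<comment> \<open>Substituting B - 2i undoes this shift: B + i becomes B - i, and -s + 2iB becomes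
    4 - s + 2iB.\<close>
  then have "pcompose (?F * [:\<i>, 1:]) [:- (2 * \<i>), 1:]
      = pcompose [:- s, 2 * \<i>:] [:- (2 * \<i>), 1:]"
    by (simp only:)
  moreover have "pcompose ?F [:- (2 * \<i>), 1:] = F"
    by (simp add: pcompose_assoc[symmetric] pcompose_pCons)
  moreover have "pcompose [:\<i>, 1:] [:- (2 * \<i>), 1:] = [:- \<i>, 1:]"
    "pcompose [:- s, 2 * \<i>:] [:- (2 * \<i>), 1:] = [:4 - s, 2 * \<i>:]"
    by (simp_all add: pcompose_pCons)
  ultimately show ?thesis
    by (simp only: pcompose_mult)
qed

theorem theorem3p2:
  fixes s :: complex
  shows "(\<forall>w0 w1 T. polynomial_seed w0 w1 T \<longrightarrow>
           (\<exists>!F :: complex poly. w0 = weyl_b * weyl_eval F B_f) \<and>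
           (has_boundary s T \<longrightarrow>
             (\<forall>F :: complex poly. w0 = weyl_b * weyl_eval F B_f \<longrightarrow>
               Fract F 1 = Fract [:4 - s, 2 * \<i>:] [:- \<i>, 1:]))) \<and>
         (s \<noteq> 2 \<longrightarrow> \<not> (\<exists>w0 w1 T. polynomial_seed w0 w1 T \<and> has_boundary s T))"
proof (intro conjI allI impI notI)
  fix w0 w1 T assume seed: "polynomial_seed w0 w1 T"
  then show "\<exists>!F. w0 = weyl_b * weyl_eval F B_f"
    by (rule polynomial_seed_normal_form)
  fix F assume "has_boundary s T" "w0 = weyl_b * weyl_eval F B_f"
  then have "F * [:- \<i>, 1:] = [:4 - s, 2 * \<i>:]"
    using seed boundary_poly_eq by blast
  then show "Fract F 1 = Fract [:4 - s, 2 * \<i>:] [:- \<i>, 1:]"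
    \<comment> \<open>Equality of fractions is the cross-multiplied identity; the products are kept
      unexpanded so that it matches.\<close>
    by (simp add: eq_fract del: mult_pCons_right mult_pCons_left)
next
  assume "s \<noteq> 2" and "\<exists>w0 w1 T. polynomial_seed w0 w1 T \<and> has_boundary s T"
  then obtain w0 w1 T where T: "polynomial_seed w0 w1 T" "has_boundary s T" by blast
  then obtain F where "w0 = weyl_b * weyl_eval F B_f"
    using polynomial_seed_normal_form by blast
  \<comment> \<open>At i, the root of B - i, the left side is 0 and the right side is 2 - s.\<close>
  with T have "poly (F * [:- \<i>, 1:]) \<i> = poly [:4 - s, 2 * \<i>:] \<i>"
    by (simp only: boundary_poly_eq)
  then have "s = 2" by (simp add: algebra_simps)
  with \<open>s \<noteq> 2\<close> show False by simp
qed

end
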